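(* Let $p$ be a prime number, $s\ge 1$ an integer, $n\in\mathbb{Z}^+$ and $\gamma\in\mathbb{Z}$ such that $0<|\gamma|<n$. Let $q\ne p$ be a prime number such that one of the following holds: (a) $q$ divides $(\gamma+1)n+(s-1)\gamma$, $q^r\,\|\,(\gamma+1)n+(s-1)\gamma$, and $q$ is self-conjugate modulo $up$ for some divisor $u\ge 1$ of $n+s$ with $q\nmid u$; or (b) $q$ divides $n-\gamma$, $q^r\,\|\,n-\gamma$, and $q$ is self-conjugate modulo $up$ for some divisor $u>1$ of $n+s$ with $q\nmid u$. If there exists an almost $p$-ary nearly perfect sequence of type $\gamma$ and period $n+s$ with $s$ zero-symbols, then $r$ is even.
   Context: An almost $p$-ary sequence of period $n+s$ with $s$ zero-symbols is a sequence $\underline{a}=(a_0,a_1,\ldots,a_{n+s-1},\ldots)$ of complex numbers of period $n+s$ (so $a_{i+n+s}=a_i$) for which there is a set $\{i_1,\ldots,i_s\}\subset\{0,1,\ldots,n+s-1\}$ of $s$ indices such that $a_{i_j}=0$ for $j=1,\ldots,s$, and $a_i=\zeta_p^{b_i}$ for some integer $b_i$ for every $i\in\{0,1,\ldots,n+s-1\}\setminus\{i_1,\ldots,i_s\}$, where $\zeta_p\in\mathbb{C}$ is a primitive $p$-th root of unity. Its autocorrelation function is $C_{\underline{a}}(t)=\sum_{i=0}^{n+s-1}a_i\overline{a_{i+t}}$ for $0\le t\le n+s-1$. The sequence is a nearly perfect sequence (NPS) of type $\gamma$ if $C_{\underline{a}}(t)=\gamma$ for all $1\le t\le n+s-1$.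 For a prime $q$ and an integer $v\ge 1$ written as $v=q^e w$ with $\gcd(q,w)=1$, $q$ is called self-conjugate modulo $v$ if $q^j\equiv -1\pmod w$ for some integer $j$. The notation $q^r\,\|\,M$ means $q^r\mid M$ and $q^{r+1}\nmid M$. *)

theory Defs
  imports Complex_Main "HOL-Number_Theory.Number_Theory"
begin

definition primitive_root_of_unity :: "nat \<Rightarrow> complex \<Rightarrow> bool" where
  "primitive_root_of_unity p \<zeta> \<longleftrightarrow> p > 0 \<and> \<zeta> ^ p = 1 \<and> (\<forall>k. 0 < k \<and> k < p \<longrightarrow> \<zeta> ^ k \<noteq> 1)"

text \<open>Here \<open>N\<close> is a period, not necessarily the least one, and \<open>I\<close> is the set of positions of
  the zero-symbols. All nonzero entries are powers of the same primitive root \<open>\<zeta>\<close>.\<close>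

definition almost_p_ary :: "nat \<Rightarrow> nat \<Rightarrow> nat \<Rightarrow> (nat \<Rightarrow> complex) \<Rightarrow> bool" where
  "almost_p_ary p N s a \<longleftrightarrow>
     (\<forall>i. a (i + N) = a i) \<and>
     (\<exists>\<zeta> I. primitive_root_of_unity p \<zeta> \<and> I \<subseteq> {0..<N} \<and> card I = s \<and>
        (\<forall>i\<in>I. a i = 0) \<and>
        (\<forall>i\<in>{0..<N} - I. \<exists>b::int. a i = \<zeta> powi b))"

definition autocorrelation :: "nat \<Rightarrow> (nat \<Rightarrow> complex) \<Rightarrow> nat \<Rightarrow> complex" where
  "autocorrelation N a t = (\<Sum>i = 0..<N. a i * cnj (a (i + t)))"

definition nearly_perfect :: "nat \<Rightarrow> int \<Rightarrow> (nat \<Rightarrow> complex) \<Rightarrow> bool" where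
  "nearly_perfect N \<gamma> a \<longleftrightarrow> (\<forall>t. 1 \<le> t \<and> t < N \<longrightarrow> autocorrelation N a t = of_int \<gamma>)"

text \<open>The exponent \<open>j\<close> may be taken in \<open>nat\<close>: \<open>q\<close> is a unit modulo \<open>w\<close>, so each of its
  integer powers is congruent to one with a nonnegative exponent.\<close>

definition self_conjugate :: "nat \<Rightarrow> nat \<Rightarrow> bool" where
  "self_conjugate q v \<longleftrightarrow>
     (\<exists>e w. v = q ^ e * w \<and> coprime q w \<and> (\<exists>j::nat. [int q ^ j = -1] (mod int w)))"

definition exactly_divides :: "nat \<Rightarrow> nat \<Rightarrow> int \<Rightarrow> bool" where
  "exactly_divides q r M \<longleftrightarrow> int q ^ r dvd M \<and> \<not> int q ^ (r + 1) dvd M"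

end

theory Submission
  imports Defs "Jordan_Normal_Form.Char_Poly"
begin

text \<open>
  Let \<open>N = n + s\<close> and let \<open>a\<close> be the sequence. For a complex number \<open>\<eta>\<close> with \<open>\<eta> ^ N = 1\<close>, put
  \<open>S = (\<Sum>i<N. a i * \<eta> ^ i)\<close>. Multiplying \<open>S\<close> by its conjugate turns the correlations of \<open>a\<close>
  into \<open>\<bar>S\<bar>\<^sup>2 = (\<Sum>t<N. C t * cnj \<eta> ^ t)\<close>, and since \<open>C 0 = n\<close> and \<open>C t = \<gamma>\<close> otherwise, this
  is \<open>(\<gamma> + 1) * n + (s - 1) * \<gamma>\<close> for \<open>\<eta> = 1\<close> and \<open>n - \<gamma>\<close> for \<open>\<eta> \<noteq> 1\<close>
  (\<open>norm_character_sum_nearly_perfect\<close>). These are the integers of the two alternatives of the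
  hypothesis; the second one needs a nontrivial \<open>\<eta>\<close>, which exists among the \<open>u\<close>-th roots of unity
  exactly when \<open>u > 1\<close>.

  If \<open>\<eta> ^ u = 1\<close>, then every summand of \<open>S\<close> is zero or an \<open>m\<close>-th root of unity for \<open>m = u * p\<close>,
  so \<open>S\<close> lies in \<open>\<int>[\<omega>]\<close> with \<open>\<omega> = cis (2 * pi / m)\<close>. It remains to see that an element \<open>X\<close> of
  \<open>\<int>[\<omega>]\<close> whose norm \<open>X * cnj X\<close> is an integer \<open>M\<close> forces the exponent of \<open>q\<close> in \<open>M\<close> to be even
  when some \<open>Q = q ^ j\<close> is \<open>-1\<close> modulo \<open>m\<close> (\<open>even_exponent_if_norm\<close>).

  The usual argument says that every prime ideal over \<open>q\<close> is fixed by complex conjugation.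
  Ideals can be avoided: the Frobenius congruence \<open>f(x) ^ Q \<equiv> f(x ^ Q)\<close> modulo \<open>q\<close> holds for
  integer polynomials \<open>f\<close>, and \<open>\<omega> ^ Q = cnj \<omega>\<close>, so \<open>cnj X \<equiv> X ^ Q\<close> modulo \<open>q\<close>. If \<open>q\<close> divides
  \<open>M = X * cnj X\<close>, then \<open>X ^ (Q + 1) \<equiv> 0\<close>; as also \<open>X = cnj (cnj X) \<equiv> X ^ (Q * Q)\<close>, it follows
  that \<open>q\<close> divides \<open>X\<close> itself in \<open>\<int>[\<omega>]\<close> (\<open>prime_dvd_if_dvd_norm\<close>). Dividing \<open>X\<close> by \<open>q\<close> divides
  \<open>M\<close> by \<open>q\<^sup>2\<close>, and the quotient is again an integer because rational elements of \<open>\<int>[\<omega>]\<close> are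
  integers. Hence the factors \<open>q\<close> of \<open>M\<close> can be removed in pairs.
\<close>

section \<open>Values of integer polynomials at roots of unity\<close>

text \<open>
  The range of \<open>\<lambda>f. eval_int f z\<close> is the ring \<open>\<int>[z]\<close>. Its elements are handled through the
  polynomials \<open>f\<close>, so that congruences modulo \<open>q\<close> in \<open>\<int>[z]\<close> can be derived from divisibility in
  the type of integer polynomials.
\<close>

definition eval_int :: "int poly \<Rightarrow> complex \<Rightarrow> complex" where
  "eval_int f z = poly (map_poly of_int f) z"

lemma eval_int_simps [simp]:
  "eval_int (f + g) z = eval_int f z + eval_int g z"
  "eval_int (f - g) z = eval_int f z - eval_int g z"
  "eval_int (f * g) z = eval_int f z * eval_int g z"
  "eval_int (f ^ k) z = eval_int f z ^ k"
  "eval_int [:c:] z = of_int c"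
  "eval_int (of_nat k) z = of_nat k"
  "eval_int (smult c f) z = of_int c * eval_int f z"
  "eval_int 0 z = 0"
  "eval_int (monom 1 k) z = z ^ k"
  by (simp_all add: eval_int_def hom_distribs poly_monom)

lemma eval_int_pcompose:
  "eval_int (pcompose f g) z = eval_int f (eval_int g z)"
  by (induction f) (simp_all add: eval_int_def pcompose_pCons hom_distribs)

lemma eval_int_sum: "eval_int (\<Sum>i\<in>A. f i) z = (\<Sum>i\<in>A. eval_int (f i) z)"
  by (induction A rule: infinite_finite_induct) simp_all

lemma eval_int_altdef: "eval_int f z = (\<Sum>i\<le>degree f. of_int (coeff f i) * z ^ i)"
  by (simp add: eval_int_def poly_altdef)

lemma cnj_eval_int: "cnj (eval_int f z) = eval_int f (cnj z)"
  by (simp add: eval_int_altdef)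

text \<open>
  The determinant trick: the vector with entries \<open>v i\<close> is an eigenvector of the integer matrix \<open>C\<close>
  with eigenvalue \<open>y\<close>, so \<open>y\<close> is a root of the characteristic polynomial, which is monic with
  integer coefficients.
\<close>

lemma algebraic_int_if_integer_matrix:
  fixes y :: complex and C :: "nat \<Rightarrow> nat \<Rightarrow> int"
  assumes eq: "\<And>i. i < m \<Longrightarrow> y * v i = (\<Sum>k<m. of_int (C i k) * v k)"
    and nz: "i0 < m" "v i0 \<noteq> 0"
  shows "algebraic_int y"
proof -
  define A :: "int mat" where "A = mat m m (\<lambda>(i, k). C i k)"
  define A' :: "complex mat" where "A' = map_mat of_int A"
  have A: "A \<in> carrier_mat m m" and A': "A' \<in> carrier_mat m m"
    by (auto simp: A_def A'_def)
  have "eigenvector A' (vec m v) y"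
    unfolding eigenvector_def
  proof (intro conjI)
    show "vec m v \<noteq> 0\<^sub>v (dim_row A')"
      using nz A' by (metis carrier_matD(1) index_vec index_zero_vec(1))
    show "A' *\<^sub>v vec m v = y \<cdot>\<^sub>v vec m v"
      by (rule eq_vecI)
         (auto simp: A'_def A_def eq scalar_prod_def atLeast0LessThan intro!: sum.cong)
  qed (use A' in auto)
  hence "poly (char_poly A') y = 0"
    using eigenvalue_root_char_poly[OF A'] by (auto simp: eigenvalue_def)
  also have "char_poly A' = map_poly of_int (char_poly A)"
    unfolding A'_def by (rule of_int_hom.char_poly_hom[OF A])
  finally show ?thesis
    using degree_monic_char_poly[OF A] by (auto simp: algebraic_int_altdef_ipoly)
qed

text \<open>
  Multiplication by an element of \<open>\<int>[z]\<close> maps the finitely many generators \<open>z ^ i\<close> with \<open>i < m\<close>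
  to integer combinations of themselves, since exponents of \<open>z\<close> only matter modulo \<open>m\<close>.
\<close>

lemma algebraic_int_eval_int_root_of_unity:
  assumes "z ^ m = 1" "m > 0"
  shows "algebraic_int (eval_int f z)"
proof -
  define C where "C i k = (\<Sum>j | j \<le> degree f \<and> (i + j) mod m = k. coeff f j)" for i k
  have "eval_int f z * z ^ i = (\<Sum>k<m. of_int (C i k) * z ^ k)" for i
  proof -
    have "eval_int f z * z ^ i = (\<Sum>j\<le>degree f. of_int (coeff f j) * z ^ (i + j))"
      by (simp add: eval_int_altdef sum_distrib_left sum_distrib_right power_add mult_ac)
    also have "\<dots> = (\<Sum>j\<le>degree f. of_int (coeff f j) * z ^ ((i + j) mod m))"
    proof (intro sum.cong refl)
      fix j
      have "z ^ (i + j) = (z ^ m) ^ ((i + j) div m) * z ^ ((i + j) mod m)"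
        by (metis mult_div_mod_eq power_add power_mult)
      thus "of_int (coeff f j) * z ^ (i + j) = of_int (coeff f j) * z ^ ((i + j) mod m)"
        by (simp add: assms)
    qed
    also have "\<dots> = (\<Sum>k<m. \<Sum>j | j \<in> {..degree f} \<and> (i + j) mod m = k.
                       of_int (coeff f j) * z ^ ((i + j) mod m))"
      by (rule sum.group[symmetric]) (use assms in auto)
    also have "\<dots> = (\<Sum>k<m. of_int (C i k) * z ^ k)"
      by (intro sum.cong refl) (simp add: C_def sum_distrib_right)
    finally show ?thesis .
  qed
  thus ?thesis
    by (intro algebraic_int_if_integer_matrix[where v = "\<lambda>i. z ^ i" and C = C
          and m = m and ?i0.0 = 0])
       (use assms in auto)
qed

section \<open>The Frobenius congruence for integer polynomials\<close>

lemma prime_dvd_add_power: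
  fixes x y :: "'a :: comm_ring_1"
  assumes "prime q"
  shows "of_nat q dvd (x + y) ^ q - (x ^ q + y ^ q)"
proof -
  have q: "q > 1" using assms by (rule prime_gt_1_nat)
  let ?t = "\<lambda>k. of_nat (q choose k) * x ^ k * y ^ (q - k)"
  have "{..q} = insert 0 (insert q {1..<q})" using q by auto
  hence "(x + y) ^ q = x ^ q + y ^ q + (\<Sum>k\<in>{1..<q}. ?t k)"
    using q by (simp add: binomial_ring algebra_simps)
  moreover have "of_nat q dvd (\<Sum>k\<in>{1..<q}. ?t k)"
  proof (rule dvd_sum)
    fix k assume "k \<in> {1..<q}"
    hence "q dvd (q choose k)" using assms by (intro dvd_choose_prime) auto
    hence "of_nat q dvd (of_nat (q choose k) :: 'a)" by (auto simp: dvd_def)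
    thus "of_nat q dvd ?t k" by (simp add: mult.assoc dvd_mult2)
  qed
  ultimately show ?thesis by simp
qed

text \<open>
  Induction on the coefficients: the congruence is additive by the previous lemma, holds for
  constants by Fermat's little theorem, and is compatible with multiplication by the variable.
\<close>

lemma frobenius_int_poly:
  fixes f :: "int poly"
  assumes "prime q"
  shows "of_nat q dvd f ^ q - pcompose f (monom 1 q)"
proof (induction f)
  case 0
  then show ?case using assms by (simp add: power_0_left prime_gt_0_nat)
next
  case (pCons c f)
  have q: "q > 0" using assms prime_gt_0_nat by blast
  have fermat: "of_nat q dvd [:c:] ^ q - [:c:]"
  proof -
    have "[c ^ q = c] (mod int q)"
    proof (cases "int q dvd c")
      case True
      hence "int q dvd c ^ q - c" using q by (intro dvd_diff dvd_trans[OF _ dvd_power]) auto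
      thus ?thesis by (simp add: cong_iff_dvd_diff)
    next
      case False
      obtain d where d: "c mod int q = int d" by (metis pos_mod_sign nonneg_int_cases of_nat_0_less_iff q)
      have cd: "[c = int d] (mod int q)" by (simp add: cong_def flip: d)
      have "\<not> q dvd d" using False cd
        by (metis cong_dvd_iff int_dvd_int_iff cong_sym)
      hence "[d ^ (q - 1) = 1] (mod q)" by (rule fermat_theorem[OF assms])
      hence "[d ^ (q - 1) * d = 1 * d] (mod q)" by (rule cong_scalar_right)
      hence "[d ^ q = d] (mod q)" using q by (metis power_minus_mult mult_1)
      hence "[int d ^ q = int d] (mod int q)" by (metis cong_int_iff of_nat_power)
      thus ?thesis using cd by (metis cong_pow cong_sym cong_trans)
    qed
    then obtain e where "c ^ q - c = int q * e" by (auto simp: cong_iff_dvd_diff)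
    hence "[:c:] ^ q - [:c:] = of_nat q * [:e:]" by (simp add: of_nat_poly poly_const_pow)
    thus ?thesis by (rule dvdI)
  qed
  have eq: "pCons c f = [:c:] + monom 1 1 * f" by (simp add: monom_altdef)
  have "of_nat q dvd (pCons c f ^ q - ([:c:] ^ q + (monom 1 1 * f) ^ q))"
    unfolding eq by (rule prime_dvd_add_power[OF assms])
  moreover note fermat
  moreover have "of_nat q dvd monom 1 q * (f ^ q - pcompose f (monom 1 q))"
    using pCons by simp
  ultimately have "of_nat q dvd (pCons c f ^ q - ([:c:] ^ q + (monom 1 1 * f) ^ q))
      + ([:c:] ^ q - [:c:]) + monom 1 q * (f ^ q - pcompose f (monom 1 q))"
    by (intro dvd_add)
  also have "\<dots> = pCons c f ^ q - pcompose (pCons c f) (monom 1 q)"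
    by (simp add: pcompose_pCons algebra_simps power_mult_distrib monom_power)
  finally show ?case .
qed

lemma frobenius_power_int_poly:
  fixes f :: "int poly"
  assumes "prime q"
  shows "of_nat q dvd f ^ (q ^ j) - pcompose f (monom 1 (q ^ j))"
proof (induction j)
  case 0
  then show ?case by (simp add: monom_altdef)
next
  case (Suc j)
  let ?g = "pcompose f (monom 1 (q ^ j))"
  have "f ^ (q ^ j) - ?g dvd (f ^ (q ^ j)) ^ q - ?g ^ q"
    by (simp add: power_diff_sumr2)
  hence "of_nat q dvd (f ^ (q ^ j)) ^ q - ?g ^ q" using Suc by (rule dvd_trans[rotated])
  moreover have "of_nat q dvd ?g ^ q - pcompose ?g (monom 1 q)"
    by (rule frobenius_int_poly[OF assms])
  ultimately have "of_nat q dvd ((f ^ (q ^ j)) ^ q - ?g ^ q) + (?g ^ q - pcompose ?g (monom 1 q))"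
    by (rule dvd_add)
  also have "pcompose ?g (monom 1 q) = pcompose f (monom 1 (q ^ Suc j))"
  proof -
    have "pcompose (monom 1 k) h = (h ^ k :: int poly)" for k h
      by (induction k) (simp_all add: monom_Suc pcompose_pCons)
    thus ?thesis by (simp add: monom_power flip: pcompose_assoc)
  qed
  finally show ?case by (simp add: power_mult mult.commute[of q])
qed


section \<open>Descent at a self-conjugate prime\<close>

text \<open>This is how self-conjugacy enters: conjugation of \<open>z\<close> is a power of the Frobenius map.\<close>

lemma cnj_root_of_unity:
  fixes z :: complex
  assumes "z ^ m = 1" "m > 0" "[int Q = -1] (mod int m)"
  shows "cnj z = z ^ Q"
proof -
  have "norm z = 1" using power_eq_1_iff[OF assms(1)] assms(2) by simp
  hence *: "z * cnj z = 1" by (metis complex_norm_square of_real_1 power_one)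
  have "int m dvd int Q + 1" using assms(3) by (simp add: cong_iff_dvd_diff)
  hence "int m dvd int (Q + 1)" by (simp add: add.commute)
  hence "m dvd Q + 1" by (simp only: int_dvd_int_iff)
  then obtain k where k: "Q + 1 = m * k" by blast
  have "z * z ^ Q = z ^ (m * k)" by (simp flip: k)
  also have "\<dots> = 1" by (simp add: power_mult assms(1))
  finally show ?thesis using * by (metis mult_left_cancel mult_zero_left zero_neq_one)
qed

text \<open>
  Writing \<open>X = eval_int f z\<close> and \<open>Q = q ^ j\<close>, the Frobenius congruence gives \<open>cnj X \<equiv> X ^ Q\<close> and
  \<open>X \<equiv> X ^ (Q * Q)\<close> modulo \<open>q\<close>. The norm is thus congruent to \<open>X ^ (Q + 1)\<close>, a power that divides
  \<open>X ^ (Q * Q)\<close> as soon as \<open>Q \<ge> 2\<close>, which is the purpose of \<open>j > 0\<close>. In other words, the second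
  congruence shows that \<open>\<int>[z]\<close> has no nilpotent elements modulo \<open>q\<close>.
\<close>

lemma prime_dvd_if_dvd_norm:
  assumes q: "prime q" and z: "z ^ m = 1" "m > 0"
    and sc: "[int q ^ j = -1] (mod int m)" "j > 0"
    and norm: "eval_int f z * cnj (eval_int f z) = of_int M" and "int q dvd M"
  shows "\<exists>g. eval_int f z = of_nat q * eval_int g z"
proof -
  define Q where "Q = q ^ j"
  have "q ^ 1 \<le> Q" unfolding Q_def
    using sc(2) prime_gt_0_nat[OF q] by (intro power_increasing) auto
  hence Q: "Q \<ge> 2" using prime_ge_2_nat[OF q] by simp
  have zQ: "cnj z = z ^ Q"
    by (rule cnj_root_of_unity[OF z]) (use sc in \<open>simp add: Q_def\<close>)
  have zQQ: "(z ^ Q) ^ Q = z"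
    using zQ by (metis complex_cnj_cnj complex_cnj_power)
  obtain h where h: "f ^ Q - pcompose f (monom 1 Q) = of_nat q * h"
    using frobenius_power_int_poly[OF q, of f j] by (auto simp: Q_def)
  obtain h' where h': "f ^ (Q * Q) - pcompose f (monom 1 (Q * Q)) = of_nat q * h'"
    using frobenius_power_int_poly[OF q, of f "j + j"] by (auto simp: Q_def power_add)
  obtain M' where M': "M = int q * M'" using assms by blast
  let ?X = "eval_int f z"
  from arg_cong[OF h, of "\<lambda>f. eval_int f z"]
  have 1: "?X ^ Q = cnj ?X + of_nat q * eval_int h z"
    by (simp add: eval_int_pcompose cnj_eval_int zQ algebra_simps)
  from arg_cong[OF h', of "\<lambda>f. eval_int f z"]
  have 2: "?X = ?X ^ (Q * Q) - of_nat q * eval_int h' z"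
    by (simp add: eval_int_pcompose power_mult zQQ algebra_simps)
  have "?X ^ (Q + 1) = of_int M + of_nat q * eval_int (h * f) z"
    by (simp add: 1 algebra_simps flip: norm)
  hence 3: "?X ^ (Q + 1) = of_nat q * eval_int ([:M':] + h * f) z"
    by (simp add: M' algebra_simps)
  have "Q + 1 \<le> Q * Q" using mult_le_mono1[OF Q, of Q] Q by linarith
  hence "?X ^ (Q * Q) = ?X ^ (Q + 1) * ?X ^ (Q * Q - (Q + 1))"
    by (metis le_add_diff_inverse power_add)
  hence "?X = of_nat q * eval_int (([:M':] + h * f) * f ^ (Q * Q - (Q + 1)) - h') z"
    by (subst 2) (simp add: 3[simplified] algebra_simps)
  thus ?thesis by blast
qed

text \<open>
  When \<open>q\<close> divides \<open>M\<close>, it can be divided out of \<open>eval_int f z\<close>, which lowers its exponent in \<open>M\<close>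
  by exactly two; exponent one is impossible since \<open>q\<^sup>2\<close> divides \<open>M\<close> already over the integers.
\<close>

lemma even_exponent_if_norm:
  assumes q: "prime q" and z: "z ^ m = 1" "m > 0"
    and sc: "[int q ^ j = -1] (mod int m)" "j > 0"
    and "eval_int f z * cnj (eval_int f z) = of_int M" and "exactly_divides q r M"
  shows "even r"
  using assms(6-)
proof (induction r arbitrary: f M rule: less_induct)
  case (less r)
  show ?case
  proof (cases "r = 0")
    case False
    have q0: "q > 0" using q by (rule prime_gt_0_nat)
    have "int q dvd int q ^ r" using False by simp
    hence "int q dvd M" using less.prems(2) dvd_trans unfolding exactly_divides_def by blast
    then obtain g where g: "eval_int f z = of_nat q * eval_int g z"
      using prime_dvd_if_dvd_norm[OF q z sc less.prems(1)] by blast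
    have M: "of_int M = of_nat q ^ 2 * (eval_int g z * cnj (eval_int g z))"
      using less.prems(1) by (simp add: g power2_eq_square mult_ac)
    hence M2: "eval_int g z * cnj (eval_int g z) = of_int M / of_nat q ^ 2"
      using q0 by simp
    \<comment> \<open>The norm of the quotient lies in \<open>\<int>[z]\<close> because conjugation substitutes \<open>z ^ (q ^ j)\<close> for
      \<open>z\<close>; being also the rational number \<open>M / q\<^sup>2\<close>, it is an integer.\<close>
    have "eval_int g z * cnj (eval_int g z) = eval_int (g * pcompose g (monom 1 (q ^ j))) z"
      using cnj_root_of_unity[OF z, of "q ^ j"] sc by (simp add: cnj_eval_int eval_int_pcompose)
    hence "algebraic_int (eval_int g z * cnj (eval_int g z))"
      using algebraic_int_eval_int_root_of_unity[OF z] by metis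
    moreover have "eval_int g z * cnj (eval_int g z) \<in> \<rat>" unfolding M2 by simp
    ultimately obtain M' where M': "eval_int g z * cnj (eval_int g z) = of_int M'"
      using rational_algebraic_int_is_int by (metis Ints_cases)
    have "of_int M = (of_int (int q ^ 2 * M') :: complex)" using M M' by simp
    hence MM': "M = int q ^ 2 * M'" by (simp only: of_int_eq_iff)
    have "r \<ge> 2"
    proof (rule ccontr)
      assume "\<not> r \<ge> 2"
      hence "r + 1 = 2" using False by simp
      hence "int q ^ (r + 1) dvd M" unfolding MM' by (simp only: dvd_triv_left)
      thus False using less.prems(2) by (simp add: exactly_divides_def)
    qed
    then obtain r' where r': "r = 2 + r'" by (metis le_add_diff_inverse)
    have "exactly_divides q r' M'"
      using less.prems(2) q0 by (simp add: exactly_divides_def MM' r' power_add mult.assoc power2_eq_square)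
    hence "even r'" using less.IH[OF _ M'] r' by simp
    thus ?thesis by (simp add: r')
  qed auto
qed

section \<open>Character sums of nearly perfect sequences\<close>

lemma sum_periodic_shift:
  fixes h :: "nat \<Rightarrow> 'a :: ab_group_add"
  assumes "\<And>i. h (i + N) = h i"
  shows "(\<Sum>t<N. h (i + t)) = (\<Sum>t<N. h t)"
proof (induction i)
  case (Suc i)
  have "h i + (\<Sum>t<N. h (Suc i + t)) = (\<Sum>t<Suc N. h (i + t))"
    by (subst sum.lessThan_Suc_shift) simp
  also have "\<dots> = h i + (\<Sum>t<N. h (i + t))" by (simp add: assms)
  finally show ?case using Suc by simp
qed auto

text \<open>
  The Wiener--Khinchin identity. The terms \<open>b i = a i * \<eta> ^ i\<close> are periodic too, so in the
  expansion of \<open>S * cnj S\<close> the second index can be written as \<open>i + t\<close>.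
\<close>

lemma norm_character_sum:
  fixes a :: "nat \<Rightarrow> complex"
  assumes per: "\<And>i. a (i + N) = a i" and \<eta>: "\<eta> ^ N = 1" and N: "N > 0"
  defines "S \<equiv> \<Sum>i<N. a i * \<eta> ^ i"
  shows "S * cnj S = (\<Sum>t<N. autocorrelation N a t * cnj \<eta> ^ t)"
proof -
  have "norm \<eta> = 1" using power_eq_1_iff[OF \<eta>] N by simp
  hence *: "\<eta> * cnj \<eta> = 1" by (metis complex_norm_square of_real_1 power_one)
  define b where "b i = a i * \<eta> ^ i" for i
  have b: "b (i + N) = b i" for i by (simp add: b_def per power_add \<eta>)
  have b2: "b i * cnj (b (i + t)) = a i * cnj (a (i + t)) * cnj \<eta> ^ t" for i t
  proof -
    have "b i * cnj (b (i + t)) = a i * cnj (a (i + t)) * (\<eta> * cnj \<eta>) ^ i * cnj \<eta> ^ t"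
      unfolding power_mult_distrib by (simp add: b_def power_add mult_ac)
    thus ?thesis by (simp add: *)
  qed
  have "S * cnj S = (\<Sum>i<N. b i * (\<Sum>k<N. cnj (b k)))"
    by (simp add: S_def b_def sum_distrib_right)
  also have "\<dots> = (\<Sum>i<N. b i * (\<Sum>t<N. cnj (b (i + t))))"
    by (subst sum_periodic_shift[of "\<lambda>k. cnj (b k)"]) (simp_all add: b)
  also have "\<dots> = (\<Sum>i<N. \<Sum>t<N. a i * cnj (a (i + t)) * cnj \<eta> ^ t)"
    by (simp only: sum_distrib_left b2)
  also have "\<dots> = (\<Sum>t<N. \<Sum>i<N. a i * cnj (a (i + t)) * cnj \<eta> ^ t)"
    by (rule sum.swap)
  also have "\<dots> = (\<Sum>t<N. autocorrelation N a t * cnj \<eta> ^ t)"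
    by (simp add: autocorrelation_def sum_distrib_right atLeast0LessThan)
  finally show ?thesis .
qed

text \<open>This places a character sum of the sequence in \<open>\<int>[cis (2 * pi / m)]\<close>.\<close>

lemma sum_roots_of_unity_eq_eval_int:
  assumes "finite A" "m > 0" "\<And>i. i \<in> A \<Longrightarrow> b i = 0 \<or> b i ^ m = 1"
  shows "\<exists>f. (\<Sum>i\<in>A. b i) = eval_int f (cis (2 * pi / m))"
proof -
  have "\<exists>f. b i = eval_int f (cis (2 * pi / m))" if "i \<in> A" for i
  proof (cases "b i = 0")
    case True
    thus ?thesis by (intro exI[of _ 0]) simp
  next
    case False
    hence "b i \<in> {z. z ^ m = 1}" using assms that by blast
    then obtain k where "b i = cis (2 * pi * real k / real m)"
      using bij_betw_roots_unity[OF assms(2)] by (auto simp: bij_betw_def)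
    hence "b i = eval_int (monom 1 k) (cis (2 * pi / m))"
      by (simp add: Complex.DeMoivre mult_ac)
    thus ?thesis by blast
  qed
  then obtain F where "\<And>i. i \<in> A \<Longrightarrow> b i = eval_int (F i) (cis (2 * pi / m))" by metis
  hence "(\<Sum>i\<in>A. b i) = eval_int (\<Sum>i\<in>A. F i) (cis (2 * pi / m))"
    by (simp add: eval_int_sum)
  thus ?thesis by blast
qed

lemma almost_p_ary_root_of_unity:
  assumes "almost_p_ary p N s a" "i < N" "a i \<noteq> 0"
  shows "a i ^ p = 1"
proof -
  obtain \<zeta> and b :: int where "\<zeta> ^ p = 1" "a i = \<zeta> powi b"
    using assms unfolding almost_p_ary_def primitive_root_of_unity_def
    by (metis DiffI atLeast0LessThan lessThan_iff)
  thus ?thesis by (metis power_int_1_left power_int_mult mult.commute power_int_of_nat)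
qed

lemma almost_p_ary_autocorrelation_0:
  assumes "almost_p_ary p (n + s) s a" "p > 0"
  shows "autocorrelation (n + s) a 0 = of_nat n"
proof -
  obtain \<zeta> I where I: "primitive_root_of_unity p \<zeta>" "I \<subseteq> {0..<n + s}" "card I = s"
      "\<And>i. i \<in> I \<Longrightarrow> a i = 0"
      "\<And>i. i \<in> {0..<n + s} - I \<Longrightarrow> \<exists>b::int. a i = \<zeta> powi b"
    using assms(1) unfolding almost_p_ary_def by metis
  have "\<zeta> \<noteq> 0" using I(1) by (auto simp: primitive_root_of_unity_def power_0_left)
  hence nz: "a i \<noteq> 0" if "i \<in> {0..<n + s} - I" for i using I(5)[OF that] by auto
  have "a i * cnj (a i) = (if i \<in> I then 0 else 1)" if "i \<in> {0..<n + s}" for i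
  proof (cases "i \<in> I")
    case False
    hence "norm (a i) = 1"
      using that nz power_eq_1_iff[OF almost_p_ary_root_of_unity[OF assms(1), of i]] assms(2) by auto
    thus ?thesis using False by (simp add: complex_norm_square[symmetric])
  qed (simp add: I(4))
  hence "autocorrelation (n + s) a 0 = (\<Sum>i\<in>{0..<n + s}. if i \<in> I then 0 else 1)"
    unfolding autocorrelation_def by (intro sum.cong) auto
  also have "\<dots> = of_nat (card ({0..<n + s} - I))"
    by (simp add: sum.If_cases Diff_eq)
  also have "card ({0..<n + s} - I) = n"
    using I(2,3) finite_subset[OF I(2)] by (subst card_Diff_subset) auto
  finally show ?thesis .
qed

text \<open>
  The autocorrelation is \<open>\<gamma>\<close> except for an excess of \<open>n - \<gamma>\<close> at \<open>t = 0\<close>; the constant part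
  contributes a geometric sum, which vanishes unless \<open>\<eta> = 1\<close>.
\<close>

lemma norm_character_sum_nearly_perfect:
  assumes a: "almost_p_ary p (n + s) s a" "nearly_perfect (n + s) \<gamma> a" "p > 0"
    and \<eta>: "\<eta> ^ (n + s) = 1" and N: "n + s > 0"
  defines "S \<equiv> \<Sum>i<n + s. a i * \<eta> ^ i"
  shows "S * cnj S = of_int (if \<eta> = 1 then (\<gamma> + 1) * int n + (int s - 1) * \<gamma> else int n - \<gamma>)"
proof -
  let ?N = "n + s"
  have "a (i + ?N) = a i" for i using a(1) unfolding almost_p_ary_def by blast
  from norm_character_sum[of a ?N \<eta>, OF this \<eta> N]
  have "S * cnj S = (\<Sum>t<?N. autocorrelation ?N a t * cnj \<eta> ^ t)" by (simp add: S_def)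
  also have "\<dots> = (\<Sum>t<?N. (if t = 0 then of_int (int n - \<gamma>) else 0) + of_int \<gamma> * cnj \<eta> ^ t)"
    using a(2) almost_p_ary_autocorrelation_0[OF a(1,3)]
    by (intro sum.cong) (auto simp: nearly_perfect_def)
  also have "\<dots> = of_int (int n - \<gamma>) + of_int \<gamma> * (\<Sum>t<?N. cnj \<eta> ^ t)"
    using N by (simp only: sum.distrib sum_distrib_left[symmetric]) simp
  also have "(\<Sum>t<?N. cnj \<eta> ^ t) = (if \<eta> = 1 then of_nat ?N else 0)"
  proof (cases "\<eta> = 1")
    case False
    hence "cnj \<eta> \<noteq> 1" by simp
    moreover have "cnj \<eta> ^ ?N = 1" using \<eta> by (metis complex_cnj_one complex_cnj_power)
    ultimately show ?thesis using False by (simp add: geometric_sum)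
  qed simp
  finally show ?thesis by (auto simp: algebra_simps)
qed

section \<open>The parity of the exponent\<close>

text \<open>
  For \<open>v\<close> prime to \<open>q\<close>, the modulus \<open>w\<close> in the definition of self-conjugacy is \<open>v\<close> itself.
  The witness \<open>j\<close> may be \<open>0\<close> when \<open>v \<le> 2\<close>; adding the totient of \<open>v\<close> makes it
  positive without changing the residue.
\<close>

lemma self_conjugate_positive_exponent:
  assumes "prime q" "\<not> q dvd v" "self_conjugate q v"
  obtains j where "j > 0" "[int q ^ j = -1] (mod int v)"
proof -
  obtain e w j where w: "v = q ^ e * w" "coprime q w" and j: "[int q ^ j = -1] (mod int w)"
    using assms(3) unfolding self_conjugate_def by blast
  have "e = 0" using assms(2) w(1) by (metis dvd_mult2 dvd_power gr0I)
  hence wv: "w = v" using w(1) by simp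
  have v: "v > 0" using assms(2) by (metis dvd_0_right gr0I)
  have "[q ^ totient v = 1] (mod v)" using w(2) wv by (intro euler_theorem) auto
  hence "[int q ^ totient v = 1] (mod int v)" by (metis cong_int_iff of_nat_1 of_nat_power)
  from cong_mult[OF j[unfolded wv] this] have "[int q ^ (j + totient v) = -1] (mod int v)"
    by (simp add: power_add)
  thus ?thesis using v by (intro that[of "j + totient v"]) auto
qed

text \<open>
  Both alternatives of the main theorem are instances: \<open>\<eta> = 1\<close> yields the first integer, and a
  nontrivial \<open>u\<close>-th root of unity the second.
\<close>

lemma even_exponent_character:
  fixes \<eta> :: complex
  assumes "prime p" and a: "almost_p_ary p (n + s) s a" "nearly_perfect (n + s) \<gamma> a"
    and N: "n + s > 0"
    and q: "prime q" "q \<noteq> p" "\<not> q dvd u" "self_conjugate q (u * p)"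
    and u: "u dvd n + s" and \<eta>: "\<eta> ^ u = 1"
    and r: "exactly_divides q r
          (if \<eta> = 1 then (\<gamma> + 1) * int n + (int s - 1) * \<gamma> else int n - \<gamma>)"
  shows "even r"
proof -
  have p: "p > 0" using assms(1) by (rule prime_gt_0_nat)
  have u0: "u > 0" using u N by (metis dvd_0_left gr0I less_not_refl)
  have "\<not> q dvd p" using q(1,2) assms(1) primes_dvd_imp_eq by blast
  hence "\<not> q dvd u * p" using q(1,3) prime_dvd_mult_iff by blast
  then obtain j where j: "j > 0" "[int q ^ j = -1] (mod int (u * p))"
    using self_conjugate_positive_exponent q(1,4) by blast
  have m: "u * p > 0" using u0 p by simp
  have "(a i * \<eta> ^ i) ^ (u * p) = 1" if "i < n + s" "a i \<noteq> 0" for i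
  proof -
    have "(a i * \<eta> ^ i) ^ (u * p) = (a i ^ p) ^ u * (\<eta> ^ u) ^ (p * i)"
      by (simp add: power_mult_distrib mult_ac flip: power_mult)
    thus ?thesis using almost_p_ary_root_of_unity[OF a(1) that] \<eta> by simp
  qed
  then obtain f where f: "(\<Sum>i<n + s. a i * \<eta> ^ i) = eval_int f (cis (2 * pi / real (u * p)))"
    using sum_roots_of_unity_eq_eval_int[of "{..<n + s}" "u * p" "\<lambda>i. a i * \<eta> ^ i"] m by auto
  have "\<eta> ^ (n + s) = 1" using u \<eta> by (metis dvdE power_mult power_one)
  note norm = norm_character_sum_nearly_perfect[OF a p this N]
  have z: "cis (2 * pi / real (u * p)) ^ (u * p) = 1"
    using m by (simp add: Complex.DeMoivre)
  show ?thesis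
    by (rule even_exponent_if_norm[OF q(1) z m j(2,1) norm[unfolded f] r])
qed

theorem corollary1:
  fixes p q n s r :: nat and \<gamma> :: int
  assumes "prime p" and "s \<ge> 1" and "n \<ge> 1"
    and "0 < \<bar>\<gamma>\<bar>" and "\<bar>\<gamma>\<bar> < int n"
    and "prime q" and "q \<noteq> p"
    and "(int q dvd (\<gamma> + 1) * int n + (int s - 1) * \<gamma> \<and>
          exactly_divides q r ((\<gamma> + 1) * int n + (int s - 1) * \<gamma>) \<and>
          (\<exists>u\<ge>1. u dvd n + s \<and> \<not> q dvd u \<and> self_conjugate q (u * p)))
       \<or> (int q dvd int n - \<gamma> \<and>
          exactly_divides q r (int n - \<gamma>) \<and>
          (\<exists>u>1. u dvd n + s \<and> \<not> q dvd u \<and> self_conjugate q (u * p)))"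
    and "\<exists>a. almost_p_ary p (n + s) s a \<and> nearly_perfect (n + s) \<gamma> a"
  shows "even r"
proof -
  obtain a where a: "almost_p_ary p (n + s) s a" "nearly_perfect (n + s) \<gamma> a"
    using assms(9) by blast
  have N: "n + s > 0" using assms(3) by simp
  note even_exp = even_exponent_character[OF assms(1) a N assms(6,7)]
  from assms(8) show ?thesis
  proof (elim disjE conjE exE)
    fix u assume "exactly_divides q r ((\<gamma> + 1) * int n + (int s - 1) * \<gamma>)"
      "u dvd n + s" "\<not> q dvd u" "self_conjugate q (u * p)"
    thus ?thesis by (intro even_exp[of u 1]) auto
  next
    fix u :: nat assume u: "u > 1" "u dvd n + s" "\<not> q dvd u" "self_conjugate q (u * p)"
      and r: "exactly_divides q r (int n - \<gamma>)"
    have "card {z::complex. z ^ u = 1} = u" using u by (intro card_roots_unity_eq) auto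
    hence "\<not> {z::complex. z ^ u = 1} \<subseteq> {1}"
      using u(1) card_mono[of "{1::complex}" "{z. z ^ u = 1}"] by auto
    then obtain \<eta> :: complex where "\<eta> ^ u = 1" "\<eta> \<noteq> 1" by blast
    thus ?thesis using u r by (intro even_exp[of u \<eta>]) auto
  qed
qed

end
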